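(* Let $\Gamma$ be a finitely generated discrete group with an automorphism $\phi$. Then $$\mathrm{Entp}(\phi)\ge h_{\mathrm{alg}}(\phi).$$
   Context: $C^*_r(\Gamma)$ is the reduced group $C^*$-algebra with norm $\|\cdot\|_{\mathrm{red}}$, $C_c(\Gamma)$ is the dense $*$-subalgebra of finitely supported functions $\sum_{g} c_g\delta_g$ (with convolution product), and $C_c(\Gamma)_1=\{f\in C_c(\Gamma):\|f\|_{\mathrm{red}}\le 1\}$. An automorphism $\phi$ of $\Gamma$ induces an automorphism of $C^*_r(\Gamma)$, also denoted $\phi$, with $\phi(\sum c_g\delta_g)=\sum c_g\delta_{\phi(g)}$. For a subset $Y$ of a normed space $X$ and $\delta>0$, $D(Y,\delta)$ is the infimum of $\dim Z$ over finite-dimensional subspaces $Z\subseteq X$ such that for every $y\in Y$ there is $z\in Z$ with $\|y-z\|<\delta$. Product entropy: for finite $\Omega\subseteq C_c(\Gamma)_1$ and $\delta>0$, $\mathrm{Entp}(\phi,\Omega,\delta)=\limsup_{n\to\infty}\frac1n\log D\big(\Omega\,\phi(\Omega)\cdots\phi^{n-1}(\Omega),\delta\big)$ (set of all products $a_0a_1\cdots a_{n-1}$ with $a_i\in\phi^i(\Omega)$, in the normed space $C_r^*(\Gamma)$), and $\mathrm{Entp}(\phi)=\sup_{\Omega}\sup_{\delta>0}\mathrm{Entp}(\phi,\Omega,\delta)$, with $\Omega$ ranging over finite subsets of $C_c(\Gamma)_1$. Algebraic entropy: $h_{\mathrm{alg}}(\phi)=\sup_{F\subseteq\Gamma\text{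 finite}}\limsup_{n\to\infty}\frac1n\log|F\,\phi(F)\cdots\phi^{n-1}(F)|$. *)

theory Defs
  imports
    "HOL-Analysis.Analysis"
    "HOL-Algebra.Generated_Groups"
    "HOL-Library.Extended_Nat"
begin

section \<open>The Hilbert space of square-summable functions\<close>

typedef 'a ell2 = "{f :: 'a \<Rightarrow> complex. (\<lambda>x. (cmod (f x))^2) summable_on UNIV}"
  morphisms ell2_fun Abs_ell2
  by (rule exI[of _ "\<lambda>_. 0"]) simp

setup_lifting type_definition_ell2

lemma ell2_bound:
  assumes "(\<lambda>x. (cmod (f x))^2) summable_on UNIV" and "finite F"
  shows "L2_set (\<lambda>x. cmod (f x)) F \<le> sqrt (\<Sum>\<^sub>\<infinity>x. (cmod (f x))^2)"
  unfolding L2_set_def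
  by (intro real_sqrt_le_mono finite_sum_le_infsum) (use assms in auto)

lemma ell2_boundI:
  assumes B: "\<And>F. finite F \<Longrightarrow> L2_set (\<lambda>x. cmod (f x)) F \<le> B"
  shows "(\<lambda>x. (cmod (f x))^2) summable_on UNIV"
    and "sqrt (\<Sum>\<^sub>\<infinity>x. (cmod (f x))^2) \<le> B"
proof -
  have B0: "0 \<le> B" using B[of "{}"] by simp
  have le: "(\<Sum>x\<in>F. (cmod (f x))^2) \<le> B^2" if "finite F" for F
    using B[OF that] unfolding L2_set_def by (rule sqrt_le_D)
  show s: "(\<lambda>x. (cmod (f x))^2) summable_on UNIV"
    by (rule nonneg_bdd_above_summable_on) (auto intro!: bdd_aboveI2 le)
  have "(\<Sum>\<^sub>\<infinity>x. (cmod (f x))^2) \<le> B^2"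
    by (rule infsum_le_finite_sums[OF s]) (rule le)
  then show "sqrt (\<Sum>\<^sub>\<infinity>x. (cmod (f x))^2) \<le> B"
    using B0 by (simp add: real_le_lsqrt)
qed

lemma ell2_sum_bound:
  assumes "\<And>x. cmod (h x) \<le> cmod (f x) + cmod (g x)"
    and "(\<lambda>x. (cmod (f x))^2) summable_on UNIV" and "(\<lambda>x. (cmod (g x))^2) summable_on UNIV"
    and "finite F"
  shows "L2_set (\<lambda>x. cmod (h x)) F
    \<le> sqrt (\<Sum>\<^sub>\<infinity>x. (cmod (f x))^2) + sqrt (\<Sum>\<^sub>\<infinity>x. (cmod (g x))^2)"
proof -
  have "L2_set (\<lambda>x. cmod (h x)) F \<le> L2_set (\<lambda>x. cmod (f x) + cmod (g x)) F"
    by (rule L2_set_mono) (use assms in auto)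
  also have "\<dots> \<le> L2_set (\<lambda>x. cmod (f x)) F + L2_set (\<lambda>x. cmod (g x)) F"
    by (rule L2_set_triangle_ineq)
  finally show ?thesis
    using ell2_bound[OF assms(2,4)] ell2_bound[OF assms(3,4)] by linarith
qed

lemma ell2_scale_bound:
  assumes "(\<lambda>x. (cmod (f x))^2) summable_on UNIV" and "finite F"
  shows "L2_set (\<lambda>x. cmod (c * f x)) F \<le> cmod c * sqrt (\<Sum>\<^sub>\<infinity>x. (cmod (f x))^2)"
proof -
  have "L2_set (\<lambda>x. cmod (c * f x)) F = cmod c * L2_set (\<lambda>x. cmod (f x)) F"
    by (simp add: norm_mult L2_set_right_distrib)
  then show ?thesis
    using ell2_bound[OF assms] by (simp add: mult_left_mono)
qed

instantiation ell2 :: (type) real_normed_vector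
begin

lift_definition zero_ell2 :: "'a ell2" is "\<lambda>_. 0" by simp

lift_definition plus_ell2 :: "'a ell2 \<Rightarrow> 'a ell2 \<Rightarrow> 'a ell2" is "\<lambda>f g x. f x + g x"
  by (rule ell2_boundI(1), rule ell2_sum_bound[OF norm_triangle_ineq])

lift_definition minus_ell2 :: "'a ell2 \<Rightarrow> 'a ell2 \<Rightarrow> 'a ell2" is "\<lambda>f g x. f x - g x"
  by (rule ell2_boundI(1), rule ell2_sum_bound[OF norm_triangle_ineq4])

lift_definition uminus_ell2 :: "'a ell2 \<Rightarrow> 'a ell2" is "\<lambda>f x. - f x" by simp

lift_definition scaleR_ell2 :: "real \<Rightarrow> 'a ell2 \<Rightarrow> 'a ell2" is "\<lambda>r f x. complex_of_real r * f x"
  by (rule ell2_boundI(1), rule ell2_scale_bound) auto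

lift_definition norm_ell2 :: "'a ell2 \<Rightarrow> real" is "\<lambda>f. sqrt (\<Sum>\<^sub>\<infinity>x. (cmod (f x))^2)" .

definition "dist \<xi> \<eta> = norm (\<xi> - \<eta> :: 'a ell2)"
definition "sgn \<xi> = (inverse (norm \<xi>) *\<^sub>R \<xi> :: 'a ell2)"
definition "uniformity = (INF e\<in>{0<..}. principal {(\<xi> :: 'a ell2, \<eta>). dist \<xi> \<eta> < e})"
definition "open U =
  (\<forall>\<xi>\<in>U. \<forall>\<^sub>F (\<xi>', \<eta>) in (uniformity :: ('a ell2 \<times> 'a ell2) filter). \<xi>' = \<xi> \<longrightarrow> \<eta> \<in> U)"

instance
proof
  fix \<xi> \<eta> \<zeta> :: "'a ell2" and r s :: real
  show "\<xi> + \<eta> + \<zeta> = \<xi> + (\<eta> + \<zeta>)" "\<xi> + \<eta> = \<eta> + \<xi>" "0 + \<xi> = \<xi>" "- \<xi> + \<xi> = 0" "\<xi> - \<eta> = \<xi> + - \<eta>"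
    by (transfer, simp add: fun_eq_iff)+
  show "r *\<^sub>R (\<xi> + \<eta>) = r *\<^sub>R \<xi> + r *\<^sub>R \<eta>" "(r + s) *\<^sub>R \<xi> = r *\<^sub>R \<xi> + s *\<^sub>R \<xi>"
    "r *\<^sub>R s *\<^sub>R \<xi> = (r * s) *\<^sub>R \<xi>" "1 *\<^sub>R \<xi> = \<xi>"
    by (transfer, simp add: fun_eq_iff algebra_simps)+
  show "norm (\<xi> + \<eta>) \<le> norm \<xi> + norm \<eta>"
    by transfer (rule ell2_boundI(2), rule ell2_sum_bound[OF norm_triangle_ineq])
  show "norm (r *\<^sub>R \<xi>) = \<bar>r\<bar> * norm \<xi>"
    by transfer (simp add: norm_mult power_mult_distrib infsum_cmult_right real_sqrt_mult)
  show "(norm \<xi> = 0) = (\<xi> = 0)"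
  proof
    assume "norm \<xi> = 0"
    then show "\<xi> = 0"
    proof transfer
      fix f :: "'a \<Rightarrow> complex"
      assume s: "(\<lambda>x. (cmod (f x))^2) summable_on UNIV" and "sqrt (\<Sum>\<^sub>\<infinity>x. (cmod (f x))^2) = 0"
      then have "L2_set (\<lambda>x. cmod (f x)) {x} \<le> 0" for x
        using ell2_bound[OF s, of "{x}"] by simp
      then show "f = (\<lambda>_. 0)" by (simp add: L2_set_def fun_eq_iff)
    qed
  qed (transfer, simp)
qed (rule dist_ell2_def sgn_ell2_def uniformity_ell2_def open_ell2_def)+

end

lemma ell2_fun_bound: "finite F \<Longrightarrow> L2_set (\<lambda>x. cmod (ell2_fun \<xi> x)) F \<le> norm \<xi>"
  by transfer (rule ell2_bound)

lift_definition scaleC_ell2 :: "complex \<Rightarrow> 'a ell2 \<Rightarrow> 'a ell2" is "\<lambda>c f x. c * f x"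
  by (rule ell2_boundI(1), rule ell2_scale_bound) auto

lemma bounded_linear_scaleC_ell2: "bounded_linear (scaleC_ell2 c)"
proof (rule bounded_linear_intro[where K = "cmod c"])
  fix \<xi> \<eta> :: "'a ell2" and r :: real
  show "scaleC_ell2 c (\<xi> + \<eta>) = scaleC_ell2 c \<xi> + scaleC_ell2 c \<eta>"
    "scaleC_ell2 c (r *\<^sub>R \<xi>) = r *\<^sub>R scaleC_ell2 c \<xi>"
    by (transfer, simp add: fun_eq_iff algebra_simps)+
  show "norm (scaleC_ell2 c \<xi>) \<le> norm \<xi> * cmod c"
    by (subst mult.commute, transfer) (rule ell2_boundI(2), rule ell2_scale_bound, auto)
qed


section \<open>Complex-linear structure on the operators\<close>

type_synonym 'a op = "'a ell2 \<Rightarrow>\<^sub>L 'a ell2"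

definition scaleC_op :: "complex \<Rightarrow> 'a op \<Rightarrow> 'a op" where
  "scaleC_op c T = Blinfun (\<lambda>\<xi>. scaleC_ell2 c (blinfun_apply T \<xi>))"

lemma scaleC_op_apply: "blinfun_apply (scaleC_op c T) \<xi> = scaleC_ell2 c (blinfun_apply T \<xi>)"
  unfolding scaleC_op_def
  by (subst bounded_linear_Blinfun_apply)
    (auto intro: bounded_linear_compose[OF bounded_linear_scaleC_ell2] blinfun.bounded_linear_right)

global_interpretation cop: vector_space "scaleC_op :: complex \<Rightarrow> 'a op \<Rightarrow> 'a op"
proof
  fix a b :: complex and S T :: "'a op"
  have add: "scaleC_ell2 a (\<xi> + \<eta>) = scaleC_ell2 a \<xi> + scaleC_ell2 a \<eta>"
    "scaleC_ell2 (a + b) \<xi> = scaleC_ell2 a \<xi> + scaleC_ell2 b \<xi>"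
    "scaleC_ell2 a (scaleC_ell2 b \<xi>) = scaleC_ell2 (a * b) \<xi>"
    "scaleC_ell2 1 \<xi> = \<xi>" for \<xi> \<eta> :: "'a ell2"
    by (transfer, simp add: fun_eq_iff algebra_simps)+
  show "scaleC_op a (S + T) = scaleC_op a S + scaleC_op a T"
    "scaleC_op (a + b) T = scaleC_op a T + scaleC_op b T"
    "scaleC_op a (scaleC_op b T) = scaleC_op (a * b) T"
    "scaleC_op 1 T = T"
    by (rule blinfun_eqI, simp add: scaleC_op_apply blinfun.add_left add)+
qed


section \<open>The reduced group C*-algebra\<close>

definition Cc :: "('a, 'b) monoid_scheme \<Rightarrow> ('a \<Rightarrow> complex) set" where
  "Cc G = {f. finite {g. f g \<noteq> 0} \<and> {g. f g \<noteq> 0} \<subseteq> carrier G}"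

definition delta :: "'a \<Rightarrow> 'a \<Rightarrow> complex" where
  "delta g = (\<lambda>x. if x = g then 1 else 0)"

text \<open>Convolution \<open>(f * k)(x) = (\<Sum>g. f(g) k(g\<^sup>-\<^sup>1 x))\<close>. Only \<open>f\<close> has to be finitely supported,
  so that the same formula also gives the action of \<open>f\<close> on square-summable functions.\<close>

definition conv :: "('a, 'b) monoid_scheme \<Rightarrow> ('a \<Rightarrow> complex) \<Rightarrow> ('a \<Rightarrow> complex) \<Rightarrow> 'a \<Rightarrow> complex" where
  "conv G f k = (\<lambda>x. if x \<in> carrier G then \<Sum>g | f g \<noteq> 0. f g * k (inv\<^bsub>G\<^esub> g \<otimes>\<^bsub>G\<^esub> x) else 0)"

definition Cc_monoid :: "('a, 'b) monoid_scheme \<Rightarrow> ('a \<Rightarrow> complex) monoid" where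
  "Cc_monoid G = \<lparr>carrier = Cc G, mult = conv G, one = delta \<one>\<^bsub>G\<^esub>\<rparr>"

text \<open>The left regular representation. The group lives on a carrier set inside the type \<open>'a\<close>, and
  \<open>\<ell>\<^sup>2\<close> of the group is the subspace of \<open>'a ell2\<close> of the functions vanishing off the carrier.
  \<open>lreg G f\<close> is left convolution by \<open>f\<close> on this subspace and zero on its orthogonal complement, so
  its operator norm is the reduced norm of \<open>f\<close>. It is meant for \<open>f \<in> Cc G\<close> only, where
  \<open>Abs_ell2\<close> and \<open>Blinfun\<close> are applied to a square-summable function and to a bounded linear map;
  see \<open>ell2_fun_lreg\<close> below.\<close>

definition lreg :: "('a, 'b) monoid_scheme \<Rightarrow> ('a \<Rightarrow> complex) \<Rightarrow> 'a op" where
  "lreg G f = Blinfun (\<lambda>\<xi>. Abs_ell2 (conv G f (ell2_fun \<xi>)))"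

definition norm_red :: "('a, 'b) monoid_scheme \<Rightarrow> ('a \<Rightarrow> complex) \<Rightarrow> real" where
  "norm_red G f = norm (lreg G f)"

definition Cstar_red :: "('a, 'b) monoid_scheme \<Rightarrow> 'a op set" where
  "Cstar_red G = closure (lreg G ` Cc G)"

definition Cc_ball :: "('a, 'b) monoid_scheme \<Rightarrow> ('a \<Rightarrow> complex) set" where
  "Cc_ball G = {f \<in> Cc G. norm_red G f \<le> 1}"

text \<open>The automorphism of the C*-algebra induced by \<open>\<phi>\<close>, on the dense subalgebra of finitely
  supported functions: \<open>(\<Sum>g. c\<^sub>g \<delta>\<^sub>g) \<mapsto> (\<Sum>g. c\<^sub>g \<delta>\<^bsub>\<phi> g\<^esub>)\<close>.\<close>

definition Cc_map :: "('a \<Rightarrow> 'a) \<Rightarrow> ('a \<Rightarrow> complex) \<Rightarrow> 'a \<Rightarrow> complex" where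
  "Cc_map \<phi> f = (\<lambda>x. \<Sum>g | f g \<noteq> 0. f g * delta (\<phi> g) x)"

lemma conv_bound:
  assumes "group G" "f \<in> Cc G" "finite F"
  shows "L2_set (\<lambda>x. cmod (conv G f (ell2_fun \<xi>) x)) F \<le> (\<Sum>g | f g \<noteq> 0. cmod (f g)) * norm \<xi>"
proof -
  interpret group G by fact
  let ?S = "{g. f g \<noteq> 0}"
  define t where "t g x = (if x \<in> carrier G then ell2_fun \<xi> (inv\<^bsub>G\<^esub> g \<otimes>\<^bsub>G\<^esub> x) else 0)" for g x
  have S: "?S \<subseteq> carrier G" "finite ?S" using assms(2) by (auto simp: Cc_def)
  have t: "L2_set (\<lambda>x. cmod (t g x)) F \<le> norm \<xi>" if "g \<in> carrier G" for g
  proof -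
    let ?m = "\<lambda>x. inv\<^bsub>G\<^esub> g \<otimes>\<^bsub>G\<^esub> x"
    have inj: "inj_on ?m (F \<inter> carrier G)"
      using that by (auto simp: inj_on_def)
    have "L2_set (\<lambda>x. cmod (t g x)) F
        = sqrt (\<Sum>x\<in>F \<inter> carrier G. (cmod (ell2_fun \<xi> (?m x)))^2)"
      unfolding L2_set_def t_def
      by (intro arg_cong[where f = sqrt] sum.mono_neutral_cong_right) (use assms in auto)
    also have "\<dots> = L2_set (\<lambda>x. cmod (ell2_fun \<xi> x)) (?m ` (F \<inter> carrier G))"
      unfolding L2_set_def by (simp add: sum.reindex[OF inj])
    also have "\<dots> \<le> norm \<xi>"
      by (rule ell2_fun_bound) (use assms in auto)
    finally show ?thesis .
  qed
  have sub: "L2_set (\<lambda>x. \<Sum>g\<in>A. cmod (f g) * cmod (t g x)) F \<le> (\<Sum>g\<in>A. cmod (f g)) * norm \<xi>"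
    if "finite A" "A \<subseteq> carrier G" for A
    using that
  proof (induction A)
    case empty
    then show ?case by (simp add: L2_set_def)
  next
    case (insert g A)
    have "L2_set (\<lambda>x. \<Sum>g\<in>insert g A. cmod (f g) * cmod (t g x)) F
        = L2_set (\<lambda>x. cmod (f g) * cmod (t g x) + (\<Sum>g\<in>A. cmod (f g) * cmod (t g x))) F"
      using insert by simp
    also have "\<dots> \<le> L2_set (\<lambda>x. cmod (f g) * cmod (t g x)) F
        + L2_set (\<lambda>x. \<Sum>g\<in>A. cmod (f g) * cmod (t g x)) F"
      by (rule L2_set_triangle_ineq)
    also have "\<dots> \<le> cmod (f g) * norm \<xi> + (\<Sum>g\<in>A. cmod (f g)) * norm \<xi>"
      using insert t[of g] by (intro add_mono) (auto simp flip: L2_set_right_distrib intro: mult_left_mono)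
    finally show ?case using insert by (simp add: algebra_simps)
  qed
  have "L2_set (\<lambda>x. cmod (conv G f (ell2_fun \<xi>) x)) F
      \<le> L2_set (\<lambda>x. \<Sum>g\<in>?S. cmod (f g) * cmod (t g x)) F"
  proof (rule L2_set_mono)
    fix x
    have "conv G f (ell2_fun \<xi>) x = (\<Sum>g\<in>?S. f g * t g x)"
      by (simp add: conv_def t_def)
    then show "cmod (conv G f (ell2_fun \<xi>) x) \<le> (\<Sum>g\<in>?S. cmod (f g) * cmod (t g x))"
      by (simp add: norm_mult sum_norm_le)
  qed simp
  also have "\<dots> \<le> (\<Sum>g\<in>?S. cmod (f g)) * norm \<xi>"
    by (rule sub) (use S in auto)
  finally show ?thesis .
qed

lemma ell2_fun_Abs_conv:
  assumes "group G" "f \<in> Cc G"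
  shows "ell2_fun (Abs_ell2 (conv G f (ell2_fun \<xi>))) = conv G f (ell2_fun \<xi>)"
  by (rule Abs_ell2_inverse) (use ell2_boundI(1)[OF conv_bound[OF assms]] in simp)

lemma ell2_fun_lreg:
  assumes "group G" "f \<in> Cc G"
  shows "ell2_fun (blinfun_apply (lreg G f) \<xi>) = conv G f (ell2_fun \<xi>)"
proof -
  have "bounded_linear (\<lambda>\<xi>. Abs_ell2 (conv G f (ell2_fun \<xi>)))"
  proof (rule bounded_linear_intro[where K = "\<Sum>g | f g \<noteq> 0. cmod (f g)"])
    fix \<xi> \<eta> :: "'a ell2" and r :: real
    show "Abs_ell2 (conv G f (ell2_fun (\<xi> + \<eta>)))
      = Abs_ell2 (conv G f (ell2_fun \<xi>)) + Abs_ell2 (conv G f (ell2_fun \<eta>))"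
      by (subst ell2_fun_inject[symmetric], unfold ell2_fun_Abs_conv[OF assms],
          unfold plus_ell2.rep_eq ell2_fun_Abs_conv[OF assms])
        (rule ext, simp add: conv_def distrib_left sum.distrib)
    show "Abs_ell2 (conv G f (ell2_fun (r *\<^sub>R \<xi>))) = r *\<^sub>R Abs_ell2 (conv G f (ell2_fun \<xi>))"
      by (subst ell2_fun_inject[symmetric], unfold ell2_fun_Abs_conv[OF assms],
          unfold scaleR_ell2.rep_eq ell2_fun_Abs_conv[OF assms])
        (rule ext, simp add: conv_def sum_distrib_left mult.left_commute)
    show "norm (Abs_ell2 (conv G f (ell2_fun \<xi>))) \<le> norm \<xi> * (\<Sum>g | f g \<noteq> 0. cmod (f g))"
      using ell2_boundI(2)[OF conv_bound[OF assms]]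
      by (simp add: norm_ell2.rep_eq ell2_fun_Abs_conv[OF assms] mult.commute)
  qed
  then show ?thesis
    by (simp add: lreg_def bounded_linear_Blinfun_apply ell2_fun_Abs_conv[OF assms])
qed


section \<open>Entropies\<close>

text \<open>\<open>F \<phi>(F) \<cdots> \<phi>\<^sup>n\<^sup>-\<^sup>1(F)\<close>, as a set of products in the monoid \<open>M\<close>.\<close>

primrec orbit_prod :: "('m, 'n) monoid_scheme \<Rightarrow> ('m \<Rightarrow> 'm) \<Rightarrow> 'm set \<Rightarrow> nat \<Rightarrow> 'm set" where
  "orbit_prod M \<phi> F 0 = {\<one>\<^bsub>M\<^esub>}"
| "orbit_prod M \<phi> F (Suc n) = orbit_prod M \<phi> F n <#>\<^bsub>M\<^esub> ((\<phi> ^^ n) ` F)"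

text \<open>\<open>log 0 = -\<infinity>\<close> occurs only for degenerate sets (such as the empty set or \<open>{0}\<close>); it does not affect
  the suprema below, which are nonnegative because of \<open>{1}\<close>.\<close>

definition elog :: "enat \<Rightarrow> ereal" where
  "elog d = (case d of enat k \<Rightarrow> if k = 0 then -\<infinity> else ereal (ln (real k)) | \<infinity> \<Rightarrow> \<infinity>)"

definition growth :: "(nat \<Rightarrow> enat) \<Rightarrow> ereal" where
  "growth d = limsup (\<lambda>n. ereal (1 / real n) * elog (d n))"

text \<open>The normed space \<open>X\<close> is a closed complex subspace of the operators. \<open>cop.dim\<close> is 0 for
  infinite-dimensional spaces, hence the explicit finite spanning set.\<close>

definition approx_dim :: "'a op set \<Rightarrow> 'a op set \<Rightarrow> real \<Rightarrow> enat" where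
  "approx_dim X Y \<delta> = (INF Z \<in> {Z. cop.subspace Z \<and> Z \<subseteq> X \<and> (\<exists>B. finite B \<and> cop.span B = Z) \<and>
     (\<forall>y\<in>Y. \<exists>z\<in>Z. norm (y - z) < \<delta>)}. enat (cop.dim Z))"

definition Entp_at ::
    "('a, 'b) monoid_scheme \<Rightarrow> ('a \<Rightarrow> 'a) \<Rightarrow> ('a \<Rightarrow> complex) set \<Rightarrow> real \<Rightarrow> ereal" where
  "Entp_at G \<phi> \<Omega> \<delta> =
     growth (\<lambda>n. approx_dim (Cstar_red G) (lreg G ` orbit_prod (Cc_monoid G) (Cc_map \<phi>) \<Omega> n) \<delta>)"

definition Entp :: "('a, 'b) monoid_scheme \<Rightarrow> ('a \<Rightarrow> 'a) \<Rightarrow> ereal" where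
  "Entp G \<phi> = (SUP \<Omega> \<in> {\<Omega>. finite \<Omega> \<and> \<Omega> \<subseteq> Cc_ball G}. SUP \<delta> \<in> {0<..}. Entp_at G \<phi> \<Omega> \<delta>)"

definition h_alg :: "('a, 'b) monoid_scheme \<Rightarrow> ('a \<Rightarrow> 'a) \<Rightarrow> ereal" where
  "h_alg G \<phi> = (SUP F \<in> {F. finite F \<and> F \<subseteq> carrier G}. growth (\<lambda>n. enat (card (orbit_prod G \<phi> F n))))"

definition finitely_generated :: "('a, 'b) monoid_scheme \<Rightarrow> bool" where
  "finitely_generated G \<longleftrightarrow> (\<exists>S. finite S \<and> S \<subseteq> carrier G \<and> generate G S = carrier G)"

end

(* The unitaries lambda(g) send the vector e_1 to the orthonormal vectors e_g. Hence a
   subspace Z of operators that contains every lambda(g), g in F_n = F phi(F) ... phi^(n-1)(F), up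
   to an error 1/2 is mapped by evaluation at e_1 to a subspace of l^2 of dimension at most dim Z
   that contains N = |F_n| orthonormal vectors up to an error 1/2. If P is the projection onto that
   subspace, each |P e_g|^2 is at least 3/4, while the sum of these numbers is at most the trace
   of P. So N is at most a constant times dim Z, and the constant disappears in the growth rate.
   The space l^2 is used as a real inner product space, which only doubles the dimension. *)

theory Submission
  imports Defs
begin

section \<open>Approximating orthonormal families\<close>

text \<open>Pythagoras: the expansion \<open>p\<close> has the same inner products with every
  \<open>u j\<close> as \<open>x\<close>, so \<open>x \<bullet> p\<close> and
  \<open>p \<bullet> p\<close> both equal the sum of the squared coefficients.\<close>

lemma norm_diff_orthonormal_expansion:
  fixes x :: "'v::real_inner"
  assumes "finite I" and "\<And>i j. i \<in> I \<Longrightarrow> j \<in> I \<Longrightarrow> u i \<bullet> u j = (if i = j then 1 else 0)"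
  shows "(norm (x - (\<Sum>i\<in>I. (x \<bullet> u i) *\<^sub>R u i)))\<^sup>2 = (norm x)\<^sup>2 - (\<Sum>i\<in>I. (x \<bullet> u i)\<^sup>2)"
proof -
  define p where "p = (\<Sum>i\<in>I. (x \<bullet> u i) *\<^sub>R u i)"
  have pu: "p \<bullet> u j = x \<bullet> u j" if "j \<in> I" for j
  proof -
    have "p \<bullet> u j = (\<Sum>i\<in>I. if i = j then x \<bullet> u j else 0)"
      unfolding p_def inner_sum_left by (rule sum.cong) (use that assms(2) in auto)
    then show ?thesis using that assms(1) by simp
  qed
  have xp: "x \<bullet> p = (\<Sum>i\<in>I. (x \<bullet> u i)\<^sup>2)"
    by (simp add: p_def inner_sum_right power2_eq_square)
  have "p \<bullet> p = (\<Sum>i\<in>I. (x \<bullet> u i) * (p \<bullet> u i))"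
    by (subst (2) p_def) (simp add: inner_sum_right)
  then have pp: "p \<bullet> p = (\<Sum>i\<in>I. (x \<bullet> u i)\<^sup>2)"
    by (simp add: pu power2_eq_square)
  have "(norm (x - p))\<^sup>2 = x \<bullet> x - 2 * (x \<bullet> p) + p \<bullet> p"
    by (simp add: power2_norm_eq_inner inner_diff_left inner_diff_right inner_commute)
  then show ?thesis
    using xp pp by (simp add: p_def power2_norm_eq_inner)
qed

lemma bessel_inequality:
  fixes x :: "'v::real_inner"
  assumes "finite I" and "\<And>i j. i \<in> I \<Longrightarrow> j \<in> I \<Longrightarrow> u i \<bullet> u j = (if i = j then 1 else 0)"
  shows "(\<Sum>i\<in>I. (x \<bullet> u i)\<^sup>2) \<le> (norm x)\<^sup>2"
  using norm_diff_orthonormal_expansion[OF assms, of x]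
    zero_le_power2[of "norm (x - (\<Sum>i\<in>I. (x \<bullet> u i) *\<^sub>R u i))"] by linarith

text \<open>The left side is the squared distance from \<open>x\<close> to its orthogonal projection
  onto \<open>span U\<close>. The two sides differ by the sum over \<open>U\<close> of the squares
  of \<open>x \<bullet> u - w \<bullet> u\<close>, which is nonnegative.\<close>

lemma orthonormal_expansion_best_approximation:
  fixes x :: "'v::real_inner"
  assumes "finite U" and "\<And>u v. u \<in> U \<Longrightarrow> v \<in> U \<Longrightarrow> u \<bullet> v = (if u = v then 1 else 0)"
    and "w \<in> span U"
  shows "(norm x)\<^sup>2 - (\<Sum>u\<in>U. (x \<bullet> u)\<^sup>2) \<le> (norm (x - w))\<^sup>2"
proof -
  define s where "s = (\<Sum>u\<in>U. (x \<bullet> u) * (w \<bullet> u))"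
  have ww: "(norm w)\<^sup>2 = (\<Sum>u\<in>U. (w \<bullet> u)\<^sup>2)" and xw: "x \<bullet> w = s"
  proof -
    from \<open>w \<in> span U\<close> obtain c where w: "w = (\<Sum>u\<in>U. c u *\<^sub>R u)"
      using assms(1) by (auto simp: span_finite)
    have c: "w \<bullet> u = c u" if "u \<in> U" for u
    proof -
      have "w \<bullet> u = (\<Sum>v\<in>U. if v = u then c u else 0)"
        unfolding w inner_sum_left by (rule sum.cong) (use that assms(2) in auto)
      then show ?thesis using that assms(1) by simp
    qed
    show "x \<bullet> w = s"
      by (subst w) (simp add: s_def inner_sum_right c mult.commute)
    have "w \<bullet> w = (\<Sum>u\<in>U. c u * (w \<bullet> u))"
      by (subst (2) w) (simp add: inner_sum_right)
    then show "(norm w)\<^sup>2 = (\<Sum>u\<in>U. (w \<bullet> u)\<^sup>2)"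
      by (simp only: power2_norm_eq_inner) (simp add: c power2_eq_square)
  qed
  have "0 \<le> (\<Sum>u\<in>U. (x \<bullet> u - w \<bullet> u)\<^sup>2)" by (rule sum_nonneg) simp
  also have "\<dots> = (\<Sum>u\<in>U. (x \<bullet> u)\<^sup>2) + (\<Sum>u\<in>U. (w \<bullet> u)\<^sup>2) - 2 * s"
    by (simp add: s_def power2_diff sum.distrib sum_subtractf sum_distrib_left mult.assoc)
  finally show ?thesis
    using ww xw by (simp add: power2_norm_eq_inner inner_diff_left inner_diff_right inner_commute)
qed

text \<open>Gram-Schmidt gives an orthogonal set that may contain 0; removing 0 keeps the span and
  makes normalization possible. As \<open>B\<close> may be dependent, \<open>U\<close> can be
  smaller than \<open>B\<close>.\<close>

lemma span_orthonormal_set: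
  fixes B :: "'v::real_inner set"
  assumes "finite B"
  obtains U where "finite U" "card U \<le> card B" "span U = span B"
    "\<And>u v. u \<in> U \<Longrightarrow> v \<in> U \<Longrightarrow> u \<bullet> v = (if u = v then 1 else 0)"
proof -
  obtain C where C: "finite C" "card C \<le> card B" "span C = span B" "pairwise orthogonal C"
    using basis_orthogonal[OF assms] by blast
  define U where "U = (\<lambda>c. (1 / norm c) *\<^sub>R c) ` (C - {0})"
  have "span U = span (C - {0})"
    unfolding U_def by (rule span_image_scale) (use C in auto)
  then have "span U = span B" using C by simp
  moreover have "card U \<le> card B"
    using card_image_le[of "C - {0}" "\<lambda>c. (1 / norm c) *\<^sub>R c"] card_Diff1_le[of C 0] C
    unfolding U_def by simp
  moreover have "u \<bullet> v = (if u = v then 1 else 0)" if "u \<in> U" "v \<in> U" for u v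
  proof -
    obtain c d where cd: "c \<in> C" "c \<noteq> 0" "u = (1 / norm c) *\<^sub>R c"
      "d \<in> C" "d \<noteq> 0" "v = (1 / norm d) *\<^sub>R d"
      using \<open>u \<in> U\<close> \<open>v \<in> U\<close> by (auto simp: U_def)
    have uu: "u \<bullet> u = 1" using cd
      by (simp add: dot_square_norm power2_eq_square)
    show ?thesis
    proof (cases "c = d")
      case True
      then show ?thesis using cd uu by simp
    next
      case False
      then have "c \<bullet> d = 0" using C(4) cd by (auto simp: pairwise_def orthogonal_def)
      then have "u \<bullet> v = 0" using cd by simp
      \<comment> \<open>The case \<open>u = v\<close> cannot occur here, since it would give
        \<open>u \<bullet> u = 0\<close>.\<close>
      then show ?thesis using uu by auto
    qed
  qed
  moreover have "finite U" using C by (simp add: U_def)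
  ultimately show ?thesis using that by blast
qed

text \<open>The squares of \<open>e i \<bullet> u\<close>, with \<open>U\<close> an orthonormal
  basis of \<open>span B\<close>, are summed in two orders. For fixed \<open>i\<close> the sum is
  the squared norm of the projection of \<open>e i\<close>, at least 1 - \<delta>^2 by best
  approximation; for fixed \<open>u\<close> it is at most 1 by Bessel. The total plays the role of
  the trace of the projection.\<close>

lemma card_orthonormal_approx_le:
  fixes e :: "'i \<Rightarrow> 'v::real_inner"
  assumes "finite S" "finite B"
    and e: "\<And>i j. i \<in> S \<Longrightarrow> j \<in> S \<Longrightarrow> e i \<bullet> e j = (if i = j then 1 else 0)"
    and approx: "\<And>i. i \<in> S \<Longrightarrow> \<exists>w\<in>span B. norm (e i - w) \<le> \<delta>"
  shows "(1 - \<delta>\<^sup>2) * real (card S) \<le> real (card B)"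
proof -
  obtain U where U: "finite U" "card U \<le> card B" "span U = span B"
    "\<And>u v. u \<in> U \<Longrightarrow> v \<in> U \<Longrightarrow> u \<bullet> v = (if u = v then 1 else 0)"
    using span_orthonormal_set[OF \<open>finite B\<close>] by blast
  have "1 - \<delta>\<^sup>2 \<le> (\<Sum>u\<in>U. (e i \<bullet> u)\<^sup>2)" if "i \<in> S" for i
  proof -
    obtain w where w: "w \<in> span U" "norm (e i - w) \<le> \<delta>" using approx[OF \<open>i \<in> S\<close>] U by auto
    have "(norm (e i - w))\<^sup>2 \<le> \<delta>\<^sup>2" using w by (simp add: power_mono)
    moreover have "(norm (e i))\<^sup>2 = 1" using e[OF that that] by (simp add: power2_norm_eq_inner)
    ultimately show ?thesis
      using orthonormal_expansion_best_approximation[OF U(1,4) w(1), of "e i"] by linarith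
  qed
  then have "(\<Sum>i\<in>S. 1 - \<delta>\<^sup>2) \<le> (\<Sum>i\<in>S. \<Sum>u\<in>U. (e i \<bullet> u)\<^sup>2)" by (rule sum_mono)
  also have "\<dots> = (\<Sum>u\<in>U. \<Sum>i\<in>S. (u \<bullet> e i)\<^sup>2)"
    by (subst sum.swap) (simp add: inner_commute)
  also have "\<dots> \<le> (\<Sum>u\<in>U. 1)"
  proof (rule sum_mono)
    fix u assume "u \<in> U"
    then have "(norm u)\<^sup>2 = 1" using U(4)[of u u] by (simp add: power2_norm_eq_inner)
    then show "(\<Sum>i\<in>S. (u \<bullet> e i)\<^sup>2) \<le> 1" using bessel_inequality[OF \<open>finite S\<close> e, of u] by simp
  qed
  also have "\<dots> \<le> real (card B)" using U(2) by simp
  finally show ?thesis by (simp add: mult.commute)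
qed


section \<open>Square-summable functions as a real inner product space\<close>

text \<open>Cauchy-Schwarz at each point bounds the terms by the product of the moduli, hence by the
  sum of their squares.\<close>

lemma ell2_inner_summable:
  fixes f g :: "'a \<Rightarrow> complex"
  assumes "(\<lambda>x. (cmod (f x))\<^sup>2) summable_on UNIV" and "(\<lambda>x. (cmod (g x))\<^sup>2) summable_on UNIV"
  shows "(\<lambda>x. f x \<bullet> g x) summable_on UNIV"
proof -
  have "(\<lambda>x. norm (f x \<bullet> g x)) summable_on UNIV"
  proof (rule Infinite_Sum.abs_summable_on_comparison_test')
    show "(\<lambda>x. (cmod (f x))\<^sup>2 + (cmod (g x))\<^sup>2) summable_on UNIV"
      by (rule summable_on_add[OF assms])
    fix x
    have "\<bar>f x \<bullet> g x\<bar> \<le> cmod (f x) * cmod (g x)" by (rule Cauchy_Schwarz_ineq2)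
    also have "\<dots> \<le> (cmod (f x))\<^sup>2 + (cmod (g x))\<^sup>2"
      using sum_squares_bound[of "cmod (f x)" "cmod (g x)"]
        mult_nonneg_nonneg[OF norm_ge_zero[of "f x"] norm_ge_zero[of "g x"]] by linarith
    finally show "norm (f x \<bullet> g x) \<le> (cmod (f x))\<^sup>2 + (cmod (g x))\<^sup>2" by simp
  qed
  then show ?thesis by (rule abs_summable_summable)
qed

instantiation ell2 :: (type) real_inner
begin

text \<open>This is the real part of the Hermitian inner product, as \<open>\<bullet>\<close> on
  complex numbers is the Euclidean inner product of the plane. It induces the norm already defined
  on \<open>ell2\<close>.\<close>

definition inner_ell2 :: "'a ell2 \<Rightarrow> 'a ell2 \<Rightarrow> real" where
  "inner_ell2 \<xi> \<eta> = (\<Sum>\<^sub>\<infinity>x. ell2_fun \<xi> x \<bullet> ell2_fun \<eta> x)"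

instance
proof
  fix \<xi> \<eta> \<zeta> :: "'a ell2" and r :: real
  have summ: "(\<lambda>x. ell2_fun \<xi> x \<bullet> ell2_fun \<eta> x) summable_on UNIV" for \<xi> \<eta> :: "'a ell2"
    using ell2_fun[of \<xi>] ell2_fun[of \<eta>] by (intro ell2_inner_summable) auto
  show "\<xi> \<bullet> \<eta> = \<eta> \<bullet> \<xi>" by (simp add: inner_ell2_def inner_commute)
  show "(\<xi> + \<eta>) \<bullet> \<zeta> = \<xi> \<bullet> \<zeta> + \<eta> \<bullet> \<zeta>"
    by (simp add: inner_ell2_def plus_ell2.rep_eq inner_add_left infsum_add summ)
  show "(r *\<^sub>R \<xi>) \<bullet> \<eta> = r * (\<xi> \<bullet> \<eta>)"
    by (simp add: inner_ell2_def scaleR_ell2.rep_eq infsum_cmult_right summ flip: scaleR_conv_of_real)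
  show "0 \<le> \<xi> \<bullet> \<xi>" by (simp add: inner_ell2_def infsum_nonneg)
  show n: "norm \<xi> = sqrt (\<xi> \<bullet> \<xi>)"
    by (simp add: norm_ell2.rep_eq inner_ell2_def power2_norm_eq_inner)
  show "(\<xi> \<bullet> \<xi> = 0) = (\<xi> = 0)"
    using n norm_eq_zero[of \<xi>] by simp
qed

end

section \<open>Orthonormal unit vectors and complex scalars\<close>

definition ell2_unit :: "'a \<Rightarrow> 'a ell2" where
  "ell2_unit g = Abs_ell2 (delta g)"

lemma delta_square_summable: "(\<lambda>x. (cmod (delta g x))\<^sup>2) summable_on UNIV"
proof -
  have "(\<lambda>x. (cmod (delta g x))\<^sup>2) summable_on UNIV
      \<longleftrightarrow> (\<lambda>x. (cmod (delta g x))\<^sup>2) summable_on {g}"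
    by (rule summable_on_cong_neutral) (auto simp: delta_def)
  then show ?thesis by simp
qed

lemma ell2_fun_unit: "ell2_fun (ell2_unit g) = delta g"
  unfolding ell2_unit_def by (rule Abs_ell2_inverse) (use delta_square_summable[of g] in simp)

lemma inner_ell2_unit: "ell2_unit g \<bullet> ell2_unit h = (if g = h then 1 else 0)"
proof -
  have "ell2_unit g \<bullet> ell2_unit h = (\<Sum>\<^sub>\<infinity>x. delta g x \<bullet> delta h x)"
    by (simp add: inner_ell2_def ell2_fun_unit)
  also have "\<dots> = (\<Sum>\<^sub>\<infinity>x\<in>{g}. delta g x \<bullet> delta h x)"
    by (rule infsum_cong_neutral) (auto simp: delta_def)
  finally show ?thesis by (auto simp: delta_def)
qed

text \<open>The complex line through \<xi> is thus the real span of \<xi> and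
  \<open>scaleC_ell2 \<i> \<xi>\<close>; this is the source of the factor 2 in passing to real
  dimensions.\<close>

lemma scaleC_ell2_eq:
  "scaleC_ell2 c \<xi> = Re c *\<^sub>R \<xi> + Im c *\<^sub>R scaleC_ell2 \<i> \<xi>"
proof (transfer, rule ext)
  fix c and f :: "'a \<Rightarrow> complex" and x
  have "c = complex_of_real (Re c) + complex_of_real (Im c) * \<i>"
    by (simp add: complex_eq_iff)
  then show "c * f x = complex_of_real (Re c) * f x + complex_of_real (Im c) * (\<i> * f x)"
    by (metis distrib_right mult.assoc)
qed


section \<open>Point masses in the group algebra\<close>

lemma delta_support: "{x. delta g x \<noteq> 0} = {g}"
  by (auto simp: delta_def)

lemma delta_in_Cc: "g \<in> carrier G \<Longrightarrow> delta g \<in> Cc G"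
  by (simp add: Cc_def delta_support)

text \<open>The single term of the convolution sum is nonzero at \<open>x\<close> exactly when the
  inverse of \<open>g\<close> times \<open>x\<close> is \<open>h\<close>, that is, when
  \<open>x\<close> is the product of \<open>g\<close> and \<open>h\<close>.\<close>

lemma conv_delta:
  assumes "group G" "g \<in> carrier G" "h \<in> carrier G"
  shows "conv G (delta g) (delta h) = delta (g \<otimes>\<^bsub>G\<^esub> h)"
proof
  interpret group G by fact
  fix x
  have "inv\<^bsub>G\<^esub> g \<otimes>\<^bsub>G\<^esub> x = h \<longleftrightarrow> x = g \<otimes>\<^bsub>G\<^esub> h" if "x \<in> carrier G"
    using that assms inv_solve_left by metis
  then show "conv G (delta g) (delta h) x = delta (g \<otimes>\<^bsub>G\<^esub> h) x"
    using assms by (auto simp: conv_def delta_support) (auto simp: delta_def)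
qed

lemma lreg_delta_unit:
  assumes "group G" "g \<in> carrier G"
  shows "blinfun_apply (lreg G (delta g)) (ell2_unit \<one>\<^bsub>G\<^esub>) = ell2_unit g"
proof -
  interpret group G by fact
  have "ell2_fun (blinfun_apply (lreg G (delta g)) (ell2_unit \<one>\<^bsub>G\<^esub>)) = ell2_fun (ell2_unit g)"
    using assms by (simp add: ell2_fun_lreg delta_in_Cc ell2_fun_unit conv_delta)
  then show ?thesis by (simp add: ell2_fun_inject)
qed

lemma delta_in_Cc_ball:
  assumes "group G" "g \<in> carrier G"
  shows "delta g \<in> Cc_ball G"
proof -
  have "norm (lreg G (delta g)) \<le> 1"
  proof (rule norm_blinfun_bound)
    fix \<xi> :: "'a ell2"
    have "L2_set (\<lambda>x. cmod (conv G (delta g) (ell2_fun \<xi>) x)) F \<le> norm \<xi>" if "finite F" for F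
      using conv_bound[OF assms(1) delta_in_Cc[OF assms(2)] that, of \<xi>]
      by (simp add: delta_support) (simp add: delta_def)
    then show "norm (blinfun_apply (lreg G (delta g)) \<xi>) \<le> 1 * norm \<xi>"
      using ell2_boundI(2)[of "conv G (delta g) (ell2_fun \<xi>)" "norm \<xi>"]
      by (simp add: norm_ell2.rep_eq ell2_fun_lreg[OF assms(1) delta_in_Cc[OF assms(2)]])
  qed simp
  then show ?thesis using assms by (simp add: Cc_ball_def norm_red_def delta_in_Cc)
qed

lemma Cc_map_delta: "Cc_map \<phi> (delta g) = delta (\<phi> g)"
  by (rule ext) (simp add: Cc_map_def delta_support, simp add: delta_def)

lemma Cc_map_funpow_delta: "(Cc_map \<phi> ^^ n) (delta g) = delta ((\<phi> ^^ n) g)"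
  by (induction n) (simp_all add: Cc_map_delta)

section \<open>Orbit products of point masses\<close>

lemma funpow_hom_closed:
  "\<phi> \<in> hom G G \<Longrightarrow> g \<in> carrier G \<Longrightarrow> (\<phi> ^^ n) g \<in> carrier G"
  by (induction n) (auto simp: hom_def)

lemma orbit_prod_subset:
  assumes "group G" "\<phi> \<in> hom G G" "F \<subseteq> carrier G"
  shows "orbit_prod G \<phi> F n \<subseteq> carrier G"
proof (induction n)
  case (Suc n)
  interpret group G by fact
  show ?case using Suc assms by (auto simp: set_mult_def intro!: m_closed funpow_hom_closed)
qed (use assms in \<open>simp add: group.is_monoid monoid.one_closed\<close>)

lemma finite_orbit_prod: "finite F \<Longrightarrow> finite (orbit_prod M \<phi> F n)"
  by (induction n) (auto simp: set_mult_def)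

text \<open>\<open>delta\<close> is multiplicative on the carrier and intertwines \<phi> with
  \<open>Cc_map \<phi>\<close>, so products can be formed in the group before passing to the
  algebra. This links the sets that the two entropies measure.\<close>

lemma orbit_prod_delta:
  assumes "group G" "\<phi> \<in> hom G G" "F \<subseteq> carrier G"
  shows "orbit_prod (Cc_monoid G) (Cc_map \<phi>) (delta ` F) n = delta ` orbit_prod G \<phi> F n"
proof (induction n)
  case 0
  then show ?case by (simp add: Cc_monoid_def)
next
  case (Suc n)
  have mult: "delta a \<otimes>\<^bsub>Cc_monoid G\<^esub> (Cc_map \<phi> ^^ n) (delta b) = delta (a \<otimes>\<^bsub>G\<^esub> (\<phi> ^^ n) b)"
    if "a \<in> orbit_prod G \<phi> F n" "b \<in> F" for a b
    using that orbit_prod_subset[OF assms, of n] funpow_hom_closed[OF assms(2), of b n] assms(3)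
    by (auto simp: Cc_monoid_def Cc_map_funpow_delta intro!: conv_delta[OF assms(1)])
  have "orbit_prod (Cc_monoid G) (Cc_map \<phi>) (delta ` F) (Suc n)
      = (\<Union>a\<in>orbit_prod G \<phi> F n. \<Union>b\<in>F. {delta a \<otimes>\<^bsub>Cc_monoid G\<^esub> (Cc_map \<phi> ^^ n) (delta b)})"
    by (simp add: Suc set_mult_def)
  also have "\<dots> = (\<Union>a\<in>orbit_prod G \<phi> F n. \<Union>b\<in>F. {delta (a \<otimes>\<^bsub>G\<^esub> (\<phi> ^^ n) b)})"
    using mult by simp
  also have "\<dots> = delta ` orbit_prod G \<phi> F (Suc n)"
    by (auto simp: set_mult_def)
  finally show ?case .
qed


section \<open>Dimension and growth\<close>

text \<open>Evaluation at \<xi> is complex-linear in the operator; splitting each coefficient into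
  real and imaginary part leaves at most two real spanning vectors per element of
  \<open>B\<close>.\<close>

lemma evaluation_in_real_span:
  assumes "finite B" "z \<in> cop.span B"
  shows "blinfun_apply z \<xi> \<in> span ((\<lambda>b. blinfun_apply b \<xi>) ` B
    \<union> (\<lambda>b. scaleC_ell2 \<i> (blinfun_apply b \<xi>)) ` B)" (is "_ \<in> span ?R")
proof -
  obtain c where z: "z = (\<Sum>b\<in>B. scaleC_op (c b) b)"
    using assms by (auto simp: cop.span_finite)
  have "blinfun_apply z \<xi> = (\<Sum>b\<in>B. scaleC_ell2 (c b) (blinfun_apply b \<xi>))"
    by (simp add: z blinfun.sum_left scaleC_op_apply)
  also have "\<dots> = (\<Sum>b\<in>B. Re (c b) *\<^sub>R blinfun_apply b \<xi>
      + Im (c b) *\<^sub>R scaleC_ell2 \<i> (blinfun_apply b \<xi>))"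
    by (rule sum.cong[OF refl], rule scaleC_ell2_eq)
  also have "\<dots> \<in> span ?R"
    by (intro span_sum span_add span_scale span_base) auto
  finally show ?thesis .
qed

text \<open>With error 1/2 the orthonormal estimate reads (3/4) |S| \<le> 2 dim Z, where 2 comes
  from real spans. The resulting factor 8/3 is rounded up to 4.\<close>

lemma card_le_dim_approximating_lreg:
  assumes "group G" "S \<subseteq> carrier G" "finite S"
    and "finite B" "cop.span B = Z"
    and approx: "\<And>g. g \<in> S \<Longrightarrow> \<exists>z\<in>Z. norm (lreg G (delta g) - z) < 1/2"
  shows "card S \<le> 4 * cop.dim Z"
proof -
  obtain C where C: "C \<subseteq> Z" "cop.independent C" "Z \<subseteq> cop.span C" "card C = cop.dim Z"
    using cop.basis_exists by blast
  \<comment> \<open>The basis \<open>C\<close> has the right cardinality but is not yet known to be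
    finite; it is an independent set in the span of the finite set \<open>B\<close>.\<close>
  have "finite C"
    using cop.independent_span_bound[OF \<open>finite B\<close> C(2)] C(1) assms(5) by simp
  let ?\<xi> = "ell2_unit \<one>\<^bsub>G\<^esub>"
  let ?R = "(\<lambda>b. blinfun_apply b ?\<xi>) ` C \<union> (\<lambda>b. scaleC_ell2 \<i> (blinfun_apply b ?\<xi>)) ` C"
  have \<xi>: "norm ?\<xi> = 1" by (simp add: norm_eq_sqrt_inner inner_ell2_unit)
  have "(1 - (1/2)\<^sup>2) * real (card S) \<le> real (card ?R)"
  proof (rule card_orthonormal_approx_le[where e = ell2_unit])
    fix g assume "g \<in> S"
    then obtain z where z: "z \<in> Z" "norm (lreg G (delta g) - z) < 1/2" using approx by blast
    have "ell2_unit g - blinfun_apply z ?\<xi> = blinfun_apply (lreg G (delta g) - z) ?\<xi>"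
      using \<open>g \<in> S\<close> assms(1,2) by (simp add: blinfun.diff_left lreg_delta_unit subset_iff)
    \<comment> \<open>Evaluation at a unit vector does not increase the error.\<close>
    then have "norm (ell2_unit g - blinfun_apply z ?\<xi>) \<le> 1/2"
      using norm_blinfun[of "lreg G (delta g) - z" ?\<xi>] \<xi> z(2) by simp
    moreover have "blinfun_apply z ?\<xi> \<in> span ?R"
      using evaluation_in_real_span[OF \<open>finite C\<close>] z(1) C(3) by blast
    ultimately show "\<exists>w\<in>span ?R. norm (ell2_unit g - w) \<le> 1/2" by blast
  qed (simp_all add: assms(3) \<open>finite C\<close> inner_ell2_unit)
  moreover have "card ?R \<le> card C + card C"
    by (rule order_trans[OF card_Un_le add_mono]) (rule card_image_le[OF \<open>finite C\<close>])+
  ultimately have "3 * real (card S) \<le> 8 * real (cop.dim Z)"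
    using C(4) by (simp add: power2_eq_square)
  then show ?thesis by linarith
qed

lemma card_le_approx_dim_lreg:
  assumes "group G" "S \<subseteq> carrier G" "finite S"
  shows "enat (card S) \<le> 4 * approx_dim X (lreg G ` delta ` S) (1/2)"
proof -
  let ?A = "{Z. cop.subspace Z \<and> Z \<subseteq> X \<and> (\<exists>B. finite B \<and> cop.span B = Z) \<and>
     (\<forall>y\<in>lreg G ` delta ` S. \<exists>z\<in>Z. norm (y - z) < 1/2)}"
  show ?thesis
  proof (cases "?A = {}")
    \<comment> \<open>Without an admissible subspace the infimum is \<infinity>, and the bound is
      trivial.\<close>
    case True
    then have "approx_dim X (lreg G ` delta ` S) (1/2) = \<infinity>"
      unfolding approx_dim_def by (simp only: image_empty) (simp add: Inf_enat_def)
    then show ?thesis by (simp add: numeral_eq_enat)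
  next
    case False
    \<comment> \<open>\<open>enat\<close> is well-ordered, so the infimum of a nonempty family is
      attained by some \<open>Z\<close>.\<close>
    then have "approx_dim X (lreg G ` delta ` S) (1/2) \<in> (\<lambda>Z. enat (cop.dim Z)) ` ?A"
      unfolding approx_dim_def by (metis (lifting) False equals0I image_is_empty wellorder_InfI)
    then obtain Z where Z: "Z \<in> ?A" "approx_dim X (lreg G ` delta ` S) (1/2) = enat (cop.dim Z)"
      by blast
    then obtain B where "finite B" "cop.span B = Z" by blast
    then have "card S \<le> 4 * cop.dim Z"
      by (rule card_le_dim_approximating_lreg[OF assms]) (use Z in auto)
    then show ?thesis using Z(2) by (simp add: numeral_eq_enat)
  qed
qed

section \<open>Growth rates up to a constant factor\<close>

text \<open>The factor 4 becomes a summand \<open>ln 4\<close>; the work lies in the infinite values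
  of \<open>elog\<close>. The case \<open>c = 0\<close> is included because
  \<open>1 / real n\<close> is 0 for \<open>n = 0\<close>, and there both sides vanish.\<close>

lemma elog_le_elog_mult:
  assumes "enat m \<le> 4 * d" "0 \<le> c"
  shows "ereal c * elog (enat m) \<le> ereal (c * ln 4) + ereal c * elog d"
proof (cases "c = 0")
  case False
  then have c: "c > 0" using assms by simp
  show ?thesis
  proof (cases d)
    case (enat k)
    then have le: "m \<le> 4 * k" using assms by (simp add: numeral_eq_enat)
    show ?thesis
    proof (cases "m = 0")
      case True
      then show ?thesis using c by (simp add: elog_def)
    next
      case False
      then have "k > 0" using le by simp
      have "ln (real m) \<le> ln (4 * real k)" using False le by simp
      also have "\<dots> = ln 4 + ln (real k)" using \<open>k > 0\<close> by (simp add: ln_mult)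
      finally have "c * ln (real m) \<le> c * ln 4 + c * ln (real k)"
        using c by (simp flip: distrib_left)
      then show ?thesis using False \<open>k > 0\<close> by (simp add: elog_def enat)
    qed
  next
    case infinity
    then show ?thesis using c by (simp add: elog_def)
  qed
qed (simp flip: zero_ereal_def)

text \<open>After division by \<open>n\<close> the constant contributes \<open>ln 4 / n\<close>,
  which tends to 0. Adding a sequence with limit 0 leaves the limsup unchanged.\<close>

lemma growth_mono_mult:
  assumes "\<And>n. enat (m n) \<le> 4 * d n"
  shows "growth (\<lambda>n. enat (m n)) \<le> growth d"
proof -
  have "(\<lambda>n. ln 4 / real n) \<longlonglongrightarrow> 0" by (rule lim_const_over_n)
  then have lim: "(\<lambda>n. ereal (1 / real n * ln 4)) \<longlonglongrightarrow> 0"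
    by (simp add: zero_ereal_def)
  have "growth (\<lambda>n. enat (m n))
      \<le> limsup (\<lambda>n. ereal (1 / real n * ln 4) + ereal (1 / real n) * elog (d n))"
    unfolding growth_def by (intro Limsup_mono always_eventually allI elog_le_elog_mult assms) simp
  also have "\<dots> = 0 + growth d"
    unfolding growth_def by (rule ereal_limsup_lim_add[OF lim]) simp
  finally show ?thesis by simp
qed

section \<open>Comparison of the two entropies\<close>

theorem theorem3p8:
  fixes G :: "('a, 'b) monoid_scheme" and \<phi> :: "'a \<Rightarrow> 'a"
  assumes "group G" and "finitely_generated G" and "\<phi> \<in> iso G G"
  shows "Entp G \<phi> \<ge> h_alg G \<phi>"
  unfolding h_alg_def
proof (rule SUP_least)
  fix F assume "F \<in> {F. finite F \<and> F \<subseteq> carrier G}"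
  then have F: "finite F" "F \<subseteq> carrier G" by auto
  have hom: "\<phi> \<in> hom G G" using assms(3) by (simp add: iso_def)
  \<comment> \<open>Both suprema in \<open>Entp\<close> are bounded below by one choice: the point
    masses of \<open>F\<close> as \<Omega>, and 1/2 as \<delta>.\<close>
  have "growth (\<lambda>n. enat (card (orbit_prod G \<phi> F n))) \<le> Entp_at G \<phi> (delta ` F) (1/2)"
    unfolding Entp_at_def orbit_prod_delta[OF assms(1) hom F(2)]
    by (intro growth_mono_mult card_le_approx_dim_lreg assms(1) orbit_prod_subset hom F
        finite_orbit_prod)
  also have "\<dots> \<le> (SUP \<delta> \<in> {0<..}. Entp_at G \<phi> (delta ` F) \<delta>)"
    by (rule SUP_upper) simp
  also have "\<dots> \<le> Entp G \<phi>"
    unfolding Entp_def by (rule SUP_upper) (use F delta_in_Cc_ball[OF assms(1)] in auto)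
  finally show "growth (\<lambda>n. enat (card (orbit_prod G \<phi> F n))) \<le> Entp G \<phi>" .
qed

end
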